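(* Any functor $F\colon\mathcal K\to\mathcal L$ of augmented virtual double categories preserves the cartesian and weakly cocartesian cells that define companions, conjoints or horizontal units. That is, $F$ sends each cartesian cell of $\mathcal K$ defining a companion, conjoint or horizontal unit to a cartesian cell of $\mathcal L$, and each weakly cocartesian cell of $\mathcal K$ defining a companion, conjoint or horizontal unit to a weakly cocartesian cell of $\mathcal L$.
   Context: **Augmented virtual double categories.** An augmented virtual double category $\mathcal K$ consists of: a class of objects; a category $\mathcal K_{\mathrm v}$ with these objects, whose morphisms $f\colon A\to C$ are called vertical; a directed graph $\mathcal K_{\mathrm h}$ with these objects as vertices, whose edges $J\colon A\nrightarrow B$ are called horizontal morphisms; and a class of cells. Each cell $\phi$ has a horizontal source, which is a (possibly empty) path $\underline J=(J_1,\dots,J_n)\colon A_0\nrightarrow A_n$ of horizontal morphisms; a horizontal target, which is a path $\underline K\colon C\nrightarrow D$ of length $|\underline K|\le 1$; a vertical source $f\colon A_0\to C$; and a vertical target $g\colon A_n\to D$. We write $\phi\colon\underline J\Rightarrow\underline K$. The empty path at $A$ is written $(A)$ (so $\underline K=(C)$ forces $C=D$), and $\frown$ denotes concatenation of paths. For each $n\ge 1$, each path of cells $\phi_i\colon\underline J_i\Rightarrow\underline K_i$ ($1\le i\le n$) with vertical source $f_{i-1}$ and vertical target $f_i$, and each cell $\psi\colon\underline K_1\frown\dots\frown\underline K_n\Rightarrow\underline L$ with vertical source $h$ and target $k$, there is a vertical composite $\psi\circ(\phi_1,\dots,\phi_n)\colon\underline J_1\frown\dots\frown\underline J_n\Rightarrow\underline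 L$ with vertical source $h\circ f_0$ and target $k\circ f_n$. There are horizontal identity cells $\mathrm{id}_J\colon J\Rightarrow J$ (with identities as vertical source and target) and vertical identity cells $\mathrm{id}_f\colon (A)\Rightarrow(C)$ for $f\colon A\to C$ (with vertical source and target $f$), with $\mathrm{id}_h\circ(\mathrm{id}_f)=\mathrm{id}_{h\circ f}$; write $\mathrm{id}_A:=\mathrm{id}_{\mathrm{id}_A}$. Axioms, whenever they make sense (for associativity: whenever both sides make sense): $\chi\circ(\psi_1\circ(\phi_{11},\dots,\phi_{1m_1}),\dots,\psi_n\circ(\phi_{n1},\dots,\phi_{nm_n}))=(\chi\circ(\psi_1,\dots,\psi_n))\circ(\phi_{11},\dots,\phi_{nm_n})$; $\mathrm{id}_C\circ(\phi)=\phi$; $\mathrm{id}_K\circ(\phi)=\phi$; $\phi\circ(\mathrm{id}_A)=\phi$; $\phi\circ(\mathrm{id}_{J_1},\dots,\mathrm{id}_{J_n})=\phi$; and $\psi\circ(\phi_1,\dots,\phi_i,\mathrm{id}_{f_i},\phi_{i+1},\dots,\phi_n)=\psi\circ(\phi_1,\dots,\phi_n)$ for $0\le i\le n$. **Functors.** A functor $F\colon\mathcal K\to\mathcal L$ consists of a functor $F\colon\mathcal K_{\mathrm v}\to\mathcal L_{\mathrm v}$ and assignments sending $J\colon A\nrightarrow B$ to $FJ\colon FA\nrightarrow FB$ and each cell $\phi\colon(J_1,\dots,J_n)\Rightarrow\underline K$ with vertical source $f$ and target $g$ to a cell $F\phi\colon(FJ_1,\dots,FJ_n)\Rightarrow F\underline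 K$ with vertical source $Ff$ and target $Fg$, strictly preserving vertical composition and identity cells. **Cartesian and weakly cocartesian cells.** A cell $\psi\colon\underline J\Rightarrow\underline K$ with $|\underline J|\le1$, $\underline J\colon A\nrightarrow B$, vertical source $f\colon A\to C$ and target $g\colon B\to D$, is cartesian if every cell $\chi\colon\underline H\Rightarrow\underline K$, with $\underline H\colon X_0\nrightarrow X_n$ and with vertical source $f\circ h$ and target $g\circ k$ (for any $h\colon X_0\to A$, $k\colon X_n\to B$), factors as $\chi=\psi\circ\phi$ for a unique $\phi\colon\underline H\Rightarrow\underline J$ with vertical source $h$ and target $k$. A cell $\phi\colon\underline H\Rightarrow J$ with $J\colon A\nrightarrow B$ a single horizontal morphism, vertical source $h\colon X_0\to A$ and target $k\colon X_n\to B$, is weakly cocartesian if every cell $\chi\colon\underline H\Rightarrow\underline K$ with vertical source $f\circ h$ and target $g\circ k$ (for any $f\colon A\to C$, $g\colon B\to D$ and $\underline K\colon C\nrightarrow D$ of length $\le1$) factors as $\chi=\psi\circ\phi$ for a unique $\psi\colon J\Rightarrow\underline K$ with vertical source $f$ and target $g$. **Companions, conjoints, units.** For $f\colon A\to C$: a cartesian cell $J\Rightarrow(C)$ with $J\colon A\nrightarrow C$, vertical source $f$ and target $\mathrm{id}_C$ (resp. $J\colon C\nrightarrow A$, vertical source $\mathrm{id}_C$ and target $f$) defines $J$ as the companion $f_*$ (resp. conjoint $f^*$) of $f$. A weakly cocartesian cell $(A)\Rightarrow J$ with $J\colon A\nrightarrow C$, vertical source $\mathrm{id}_A$ and target $f$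 (resp. $J\colon C\nrightarrow A$, vertical source $f$ and target $\mathrm{id}_A$) is said to define $J$ as the companion (resp. conjoint) of $f$; existence of such a cell is equivalent to existence of a cartesian one. The horizontal unit $I_A\colon A\nrightarrow A$ of an object $A$ is the companion of $\mathrm{id}_A$; it is defined by a cartesian horizontal cell $I_A\Rightarrow(A)$ or equivalently a weakly cocartesian horizontal cell $(A)\Rightarrow I_A$, a cell being horizontal if its vertical source and target are identities. *)

theory Defs
  imports Main
begin

text \<open>
  A path \<open>A\<^sub>0 \<rightarrow> A\<^sub>n\<close> of horizontal morphisms is represented by the list of its edges. The
  empty path \<open>(A)\<close> is the empty list; its object is always recovered from the vertical
  boundary of the cell at hand: the horizontal source of a cell \<open>\<phi>\<close> runs from
  \<open>vdom (vs \<phi>)\<close> to \<open>vdom (vt \<phi>)\<close>, its horizontal target from \<open>vcod (vs \<phi>)\<close> to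
  \<open>vcod (vt \<phi>)\<close>.
\<close>

record ('o, 'v, 'h, 'c) avdc_data =
  Obj :: "'o set"
  VMor :: "'v set"
  vdom :: "'v \<Rightarrow> 'o"
  vcod :: "'v \<Rightarrow> 'o"
  vid :: "'o \<Rightarrow> 'v"
  vcomp :: "'v \<Rightarrow> 'v \<Rightarrow> 'v"  (infixr "\<cdot>\<index>" 70)
  HMor :: "'h set"
  hdom :: "'h \<Rightarrow> 'o"
  hcod :: "'h \<Rightarrow> 'o"
  Cell :: "'c set"
  hs :: "'c \<Rightarrow> 'h list"
  ht :: "'c \<Rightarrow> 'h list"
  vs :: "'c \<Rightarrow> 'v"
  vt :: "'c \<Rightarrow> 'v"
  ccomp :: "'c \<Rightarrow> 'c list \<Rightarrow> 'c"  (infixr "\<odot>\<index>" 70)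
  hidc :: "'h \<Rightarrow> 'c"
  vidc :: "'v \<Rightarrow> 'c"

definition vmor :: "('o, 'v, 'h, 'c) avdc_data \<Rightarrow> 'v \<Rightarrow> 'o \<Rightarrow> 'o \<Rightarrow> bool" where
  "vmor K f A C \<longleftrightarrow> f \<in> VMor K \<and> vdom K f = A \<and> vcod K f = C"

definition hmor :: "('o, 'v, 'h, 'c) avdc_data \<Rightarrow> 'h \<Rightarrow> 'o \<Rightarrow> 'o \<Rightarrow> bool" where
  "hmor K J A B \<longleftrightarrow> J \<in> HMor K \<and> hdom K J = A \<and> hcod K J = B"

fun hpath :: "('o, 'v, 'h, 'c) avdc_data \<Rightarrow> 'o \<Rightarrow> 'h list \<Rightarrow> 'o \<Rightarrow> bool" where
  "hpath K A [] B \<longleftrightarrow> A \<in> Obj K \<and> A = B"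
| "hpath K A (J # Js) B \<longleftrightarrow> J \<in> HMor K \<and> hdom K J = A \<and> hpath K (hcod K J) Js B"

definition cell ::
  "('o, 'v, 'h, 'c) avdc_data \<Rightarrow> 'c \<Rightarrow> 'h list \<Rightarrow> 'h list \<Rightarrow> 'v \<Rightarrow> 'v \<Rightarrow> bool" where
  "cell K \<phi> Js Ks f g \<longleftrightarrow>
     \<phi> \<in> Cell K \<and> hs K \<phi> = Js \<and> ht K \<phi> = Ks \<and> vs K \<phi> = f \<and> vt K \<phi> = g"

definition cell_path :: "('o, 'v, 'h, 'c) avdc_data \<Rightarrow> 'c list \<Rightarrow> bool" where
  "cell_path K \<phi>s \<longleftrightarrow> \<phi>s \<noteq> [] \<and> set \<phi>s \<subseteq> Cell K \<and>
     (\<forall>i. Suc i < length \<phi>s \<longrightarrow> vt K (\<phi>s ! i) = vs K (\<phi>s ! Suc i))"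

text \<open>
  \<open>composable K \<psi> \<phi>s\<close> says that \<open>\<psi> \<circ> (\<phi>\<^sub>1, \<dots>, \<phi>\<^sub>n)\<close> is defined. Equality of start objects
  is required because the concatenated path may be empty; equality of the end objects
  then follows.
\<close>

definition composable :: "('o, 'v, 'h, 'c) avdc_data \<Rightarrow> 'c \<Rightarrow> 'c list \<Rightarrow> bool" where
  "composable K \<psi> \<phi>s \<longleftrightarrow> \<psi> \<in> Cell K \<and> cell_path K \<phi>s \<and>
     vdom K (vs K \<psi>) = vcod K (vs K (hd \<phi>s)) \<and>
     hs K \<psi> = concat (map (ht K) \<phi>s)"

text \<open>Each equational axiom is required exactly when both of its sides are defined.\<close>

locale avdc =
  fixes K :: "('o, 'v, 'h, 'c) avdc_data" (structure)
  assumes vmor_obj: "f \<in> VMor K \<Longrightarrow> vdom K f \<in> Obj K \<and> vcod K f \<in> Obj K"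
    and vid_vmor: "A \<in> Obj K \<Longrightarrow> vmor K (vid K A) A A"
    and vcomp_vmor: "\<lbrakk>vmor K f A B; vmor K g B C\<rbrakk> \<Longrightarrow> vmor K (g \<cdot> f) A C"
    and vcomp_vid: "vmor K f A C \<Longrightarrow> f \<cdot> vid K A = f"
    and vid_vcomp: "vmor K f A C \<Longrightarrow> vid K C \<cdot> f = f"
    and vcomp_assoc: "\<lbrakk>vmor K f A B; vmor K g B C; vmor K h C D\<rbrakk> \<Longrightarrow>
          h \<cdot> (g \<cdot> f) = (h \<cdot> g) \<cdot> f"
    and hmor_obj: "J \<in> HMor K \<Longrightarrow> hdom K J \<in> Obj K \<and> hcod K J \<in> Obj K"
    and cell_vmor: "\<phi> \<in> Cell K \<Longrightarrow> vs K \<phi> \<in> VMor K \<and> vt K \<phi> \<in> VMor K"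
    and cell_hs: "\<phi> \<in> Cell K \<Longrightarrow> hpath K (vdom K (vs K \<phi>)) (hs K \<phi>) (vdom K (vt K \<phi>))"
    and cell_ht: "\<phi> \<in> Cell K \<Longrightarrow> hpath K (vcod K (vs K \<phi>)) (ht K \<phi>) (vcod K (vt K \<phi>))"
    and cell_ht_length: "\<phi> \<in> Cell K \<Longrightarrow> length (ht K \<phi>) \<le> 1"
    and ccomp_cell: "composable K \<psi> \<phi>s \<Longrightarrow>
          cell K (\<psi> \<odot> \<phi>s) (concat (map (hs K) \<phi>s)) (ht K \<psi>)
            (vs K \<psi> \<cdot> vs K (hd \<phi>s)) (vt K \<psi> \<cdot> vt K (last \<phi>s))"
    and hidc_cell: "hmor K J A B \<Longrightarrow> cell K (hidc K J) [J] [J] (vid K A) (vid K B)"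
    and vidc_cell: "f \<in> VMor K \<Longrightarrow> cell K (vidc K f) [] [] f f"
    and vidc_vcomp: "\<lbrakk>vmor K f A B; vmor K h B C\<rbrakk> \<Longrightarrow>
          vidc K h \<odot> [vidc K f] = vidc K (h \<cdot> f)"
    and ccomp_assoc: "\<lbrakk>list_all2 (composable K) \<psi>s \<phi>ss;
          composable K \<chi> (map2 (\<odot>) \<psi>s \<phi>ss);
          composable K \<chi> \<psi>s; composable K (\<chi> \<odot> \<psi>s) (concat \<phi>ss)\<rbrakk> \<Longrightarrow>
          \<chi> \<odot> map2 (\<odot>) \<psi>s \<phi>ss = (\<chi> \<odot> \<psi>s) \<odot> concat \<phi>ss"
    and vidc_ccomp: "\<lbrakk>C \<in> Obj K; composable K (vidc K (vid K C)) [\<phi>]\<rbrakk> \<Longrightarrow>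
          vidc K (vid K C) \<odot> [\<phi>] = \<phi>"
    and hidc_ccomp: "\<lbrakk>M \<in> HMor K; composable K (hidc K M) [\<phi>]\<rbrakk> \<Longrightarrow> hidc K M \<odot> [\<phi>] = \<phi>"
    and ccomp_vidc: "\<lbrakk>A \<in> Obj K; composable K \<phi> [vidc K (vid K A)]\<rbrakk> \<Longrightarrow>
          \<phi> \<odot> [vidc K (vid K A)] = \<phi>"
    and ccomp_hidc: "\<lbrakk>set Js \<subseteq> HMor K; composable K \<phi> (map (hidc K) Js)\<rbrakk> \<Longrightarrow>
          \<phi> \<odot> map (hidc K) Js = \<phi>"
    and ccomp_insert_vidc: "\<lbrakk>f \<in> VMor K; composable K \<psi> (\<phi>s @ [vidc K f] @ \<phi>s');
          composable K \<psi> (\<phi>s @ \<phi>s')\<rbrakk> \<Longrightarrow>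
          \<psi> \<odot> (\<phi>s @ [vidc K f] @ \<phi>s') = \<psi> \<odot> (\<phi>s @ \<phi>s')"

record ('o, 'v, 'h, 'c, 'o', 'v', 'h', 'c') avdc_map =
  FO :: "'o \<Rightarrow> 'o'"
  FV :: "'v \<Rightarrow> 'v'"
  FH :: "'h \<Rightarrow> 'h'"
  FC :: "'c \<Rightarrow> 'c'"

locale avdc_functor = source: avdc K + target: avdc L
  for K :: "('o, 'v, 'h, 'c) avdc_data" and L :: "('o', 'v', 'h', 'c') avdc_data" +
  fixes F :: "('o, 'v, 'h, 'c, 'o', 'v', 'h', 'c') avdc_map"
  assumes FO_obj: "A \<in> Obj K \<Longrightarrow> FO F A \<in> Obj L"
    and FV_vmor: "vmor K f A C \<Longrightarrow> vmor L (FV F f) (FO F A) (FO F C)"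
    and FV_vid: "A \<in> Obj K \<Longrightarrow> FV F (vid K A) = vid L (FO F A)"
    and FV_vcomp: "\<lbrakk>vmor K f A B; vmor K g B C\<rbrakk> \<Longrightarrow>
          FV F (g \<cdot>\<^bsub>K\<^esub> f) = FV F g \<cdot>\<^bsub>L\<^esub> FV F f"
    and FH_hmor: "hmor K J A B \<Longrightarrow> hmor L (FH F J) (FO F A) (FO F B)"
    and FC_cell: "cell K \<phi> Js Ks f g \<Longrightarrow>
          cell L (FC F \<phi>) (map (FH F) Js) (map (FH F) Ks) (FV F f) (FV F g)"
    and FC_ccomp: "composable K \<psi> \<phi>s \<Longrightarrow>
          FC F (\<psi> \<odot>\<^bsub>K\<^esub> \<phi>s) = FC F \<psi> \<odot>\<^bsub>L\<^esub> map (FC F) \<phi>s"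
    and FC_hidc: "J \<in> HMor K \<Longrightarrow> FC F (hidc K J) = hidc L (FH F J)"
    and FC_vidc: "f \<in> VMor K \<Longrightarrow> FC F (vidc K f) = vidc L (FV F f)"

definition cartesian :: "('o, 'v, 'h, 'c) avdc_data \<Rightarrow> 'c \<Rightarrow> bool" where
  "cartesian K \<psi> \<longleftrightarrow> \<psi> \<in> Cell K \<and> length (hs K \<psi>) \<le> 1 \<and>
     (\<forall>X Y h k Hs \<chi>.
        vmor K h X (vdom K (vs K \<psi>)) \<and> vmor K k Y (vdom K (vt K \<psi>)) \<and> hpath K X Hs Y \<and>
        cell K \<chi> Hs (ht K \<psi>) (vs K \<psi> \<cdot>\<^bsub>K\<^esub> h) (vt K \<psi> \<cdot>\<^bsub>K\<^esub> k) \<longrightarrow>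
        (\<exists>!\<phi>. cell K \<phi> Hs (hs K \<psi>) h k \<and> \<chi> = \<psi> \<odot>\<^bsub>K\<^esub> [\<phi>]))"

definition weakly_cocartesian :: "('o, 'v, 'h, 'c) avdc_data \<Rightarrow> 'c \<Rightarrow> bool" where
  "weakly_cocartesian K \<phi> \<longleftrightarrow> \<phi> \<in> Cell K \<and> length (ht K \<phi>) = 1 \<and>
     (\<forall>C D f g Ks \<chi>.
        vmor K f (vcod K (vs K \<phi>)) C \<and> vmor K g (vcod K (vt K \<phi>)) D \<and>
        hpath K C Ks D \<and> length Ks \<le> 1 \<and>
        cell K \<chi> (hs K \<phi>) Ks (f \<cdot>\<^bsub>K\<^esub> vs K \<phi>) (g \<cdot>\<^bsub>K\<^esub> vt K \<phi>) \<longrightarrow>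
        (\<exists>!\<psi>. cell K \<psi> (ht K \<phi>) Ks f g \<and> \<chi> = \<psi> \<odot>\<^bsub>K\<^esub> [\<phi>]))"

definition cart_companion ::
  "('o, 'v, 'h, 'c) avdc_data \<Rightarrow> 'v \<Rightarrow> 'h \<Rightarrow> 'c \<Rightarrow> bool" where
  "cart_companion K f J \<psi> \<longleftrightarrow> (\<exists>A C. vmor K f A C \<and> hmor K J A C \<and>
     cell K \<psi> [J] [] f (vid K C) \<and> cartesian K \<psi>)"

definition cart_conjoint ::
  "('o, 'v, 'h, 'c) avdc_data \<Rightarrow> 'v \<Rightarrow> 'h \<Rightarrow> 'c \<Rightarrow> bool" where
  "cart_conjoint K f J \<psi> \<longleftrightarrow> (\<exists>A C. vmor K f A C \<and> hmor K J C A \<and>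
     cell K \<psi> [J] [] (vid K C) f \<and> cartesian K \<psi>)"

definition cart_unit ::
  "('o, 'v, 'h, 'c) avdc_data \<Rightarrow> 'o \<Rightarrow> 'h \<Rightarrow> 'c \<Rightarrow> bool" where
  "cart_unit K A I \<psi> \<longleftrightarrow> A \<in> Obj K \<and> hmor K I A A \<and>
     cell K \<psi> [I] [] (vid K A) (vid K A) \<and> cartesian K \<psi>"

definition wcocart_companion ::
  "('o, 'v, 'h, 'c) avdc_data \<Rightarrow> 'v \<Rightarrow> 'h \<Rightarrow> 'c \<Rightarrow> bool" where
  "wcocart_companion K f J \<phi> \<longleftrightarrow> (\<exists>A C. vmor K f A C \<and> hmor K J A C \<and>
     cell K \<phi> [] [J] (vid K A) f \<and> weakly_cocartesian K \<phi>)"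

definition wcocart_conjoint ::
  "('o, 'v, 'h, 'c) avdc_data \<Rightarrow> 'v \<Rightarrow> 'h \<Rightarrow> 'c \<Rightarrow> bool" where
  "wcocart_conjoint K f J \<phi> \<longleftrightarrow> (\<exists>A C. vmor K f A C \<and> hmor K J C A \<and>
     cell K \<phi> [] [J] f (vid K A) \<and> weakly_cocartesian K \<phi>)"

definition wcocart_unit ::
  "('o, 'v, 'h, 'c) avdc_data \<Rightarrow> 'o \<Rightarrow> 'h \<Rightarrow> 'c \<Rightarrow> bool" where
  "wcocart_unit K A I \<phi> \<longleftrightarrow> A \<in> Obj K \<and> hmor K I A A \<and>
     cell K \<phi> [] [I] (vid K A) (vid K A) \<and> weakly_cocartesian K \<phi>"

end

theory Submission
  imports Defs
begin

text \<open>
  A cartesian cell \<open>\<psi> : J \<Rightarrow> (C)\<close> defines \<open>J\<close> as the companion of \<open>f\<close> if and only if there is a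
  cell \<open>\<phi> : (A) \<Rightarrow> J\<close> satisfying the companion identities \<open>\<psi> \<circ> (\<phi>) = id\<^sub>f\<close> and
  \<open>id\<^sub>J \<circ> (\<phi>, \<psi>) = id\<^sub>J\<close>, and the same identities characterise the weakly cocartesian cells
  \<open>\<phi>\<close>. Being equations, they are preserved by every functor. Conjoints are companions in the
  horizontal dual, and units are companions of identities.
\<close>

section \<open>Boundaries and associativity\<close>

context avdc
begin

lemma cell_simps:
  assumes "cell K \<phi> Js Ks f g"
  shows "\<phi> \<in> Cell K" "hs K \<phi> = Js" "ht K \<phi> = Ks" "vs K \<phi> = f" "vt K \<phi> = g"
  using assms by (auto simp: cell_def)

lemma vmor_simps:
  assumes "vmor K f A C"
  shows "f \<in> VMor K" "vdom K f = A" "vcod K f = C" "A \<in> Obj K" "C \<in> Obj K"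
  using assms vmor_obj[of f] by (auto simp: vmor_def)

lemma vid_simps:
  assumes "A \<in> Obj K"
  shows "vid K A \<in> VMor K" "vdom K (vid K A) = A" "vcod K (vid K A) = A"
  using vid_vmor[OF assms] by (auto simp: vmor_def)

lemma vcomp_simps:
  assumes "f \<in> VMor K" "g \<in> VMor K" "vdom K g = vcod K f"
  shows "g \<cdot> f \<in> VMor K" "vdom K (g \<cdot> f) = vdom K f" "vcod K (g \<cdot> f) = vcod K g"
  using vcomp_vmor[of f "vdom K f" "vcod K f" g "vcod K g"] assms by (auto simp: vmor_def)

lemma vcomp_unit:
  assumes "f \<in> VMor K"
  shows "vdom K f = A \<Longrightarrow> f \<cdot> vid K A = f" "vcod K f = C \<Longrightarrow> vid K C \<cdot> f = f"
  using assms vcomp_vid vid_vcomp by (auto simp: vmor_def)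

lemma hpath_unique_end: "hpath K A Js B \<Longrightarrow> hpath K A Js B' \<Longrightarrow> B = B'"
  by (induction Js arbitrary: A) auto

lemma hpath_unique_start: "hpath K A Js B \<Longrightarrow> hpath K A' Js B \<Longrightarrow> A = A'"
  by (cases Js) auto

lemma hpath_append: "hpath K A Js B \<Longrightarrow> hpath K B Ks C \<Longrightarrow> hpath K A (Js @ Ks) C"
  by (induction Js arbitrary: A) auto

text \<open>The vertical boundaries shared by neighbouring cells make consecutive targets meet. The
  two end objects obtained here are what lets \<open>composable_hop\<close> trade a condition at the
  start of a path for one at its end.\<close>

lemma cell_path_ht:
  assumes "cell_path K \<phi>s"
  shows "hpath K (vcod K (vs K (hd \<phi>s))) (concat (map (ht K) \<phi>s)) (vcod K (vt K (last \<phi>s)))"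
  using assms
proof (induction \<phi>s)
  case Nil
  then show ?case by (simp add: cell_path_def)
next
  case (Cons \<phi> \<phi>s)
  have \<phi>: "hpath K (vcod K (vs K \<phi>)) (ht K \<phi>) (vcod K (vt K \<phi>))"
    using Cons.prems cell_ht by (auto simp: cell_path_def)
  show ?case
  proof (cases "\<phi>s = []")
    case True
    then show ?thesis using \<phi> by simp
  next
    case False
    then have "cell_path K \<phi>s"
      using Cons.prems by (fastforce simp: cell_path_def)
    moreover have "vt K \<phi> = vs K (hd \<phi>s)"
      using Cons.prems False by (force simp: cell_path_def hd_conv_nth)
    ultimately show ?thesis using Cons.IH hpath_append[OF \<phi>] False by auto
  qed
qed

lemma composable_singleton_iff:
  "composable K \<psi> [\<phi>] \<longleftrightarrow> \<psi> \<in> Cell K \<and> \<phi> \<in> Cell K \<and>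
     vdom K (vs K \<psi>) = vcod K (vs K \<phi>) \<and> hs K \<psi> = ht K \<phi>"
  by (auto simp: composable_def cell_path_def)

lemma composable_pair_iff:
  "composable K \<psi> [\<phi>\<^sub>1, \<phi>\<^sub>2] \<longleftrightarrow> \<psi> \<in> Cell K \<and> \<phi>\<^sub>1 \<in> Cell K \<and> \<phi>\<^sub>2 \<in> Cell K \<and>
     vdom K (vs K \<psi>) = vcod K (vs K \<phi>\<^sub>1) \<and> vt K \<phi>\<^sub>1 = vs K \<phi>\<^sub>2 \<and> hs K \<psi> = ht K \<phi>\<^sub>1 @ ht K \<phi>\<^sub>2"
  by (auto simp: composable_def cell_path_def less_Suc_eq)

lemmas composable_iff = composable_singleton_iff composable_pair_iff

lemma ccomp_simps:
  assumes "composable K \<psi> \<phi>s"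
  shows "\<psi> \<odot> \<phi>s \<in> Cell K" "hs K (\<psi> \<odot> \<phi>s) = concat (map (hs K) \<phi>s)"
    "ht K (\<psi> \<odot> \<phi>s) = ht K \<psi>" "vs K (\<psi> \<odot> \<phi>s) = vs K \<psi> \<cdot> vs K (hd \<phi>s)"
    "vt K (\<psi> \<odot> \<phi>s) = vt K \<psi> \<cdot> vt K (last \<phi>s)"
  using ccomp_cell[OF assms] by (auto simp: cell_def)

lemma ccomp_vs_vdom_vcod:
  assumes "composable K \<psi> \<phi>s"
  shows "vdom K (vs K (\<psi> \<odot> \<phi>s)) = vdom K (vs K (hd \<phi>s))"
    "vcod K (vs K (\<psi> \<odot> \<phi>s)) = vcod K (vs K \<psi>)"
proof -
  have "hd \<phi>s \<in> Cell K" "\<psi> \<in> Cell K" "vdom K (vs K \<psi>) = vcod K (vs K (hd \<phi>s))"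
    using assms by (auto simp: composable_def cell_path_def)
  then show "vdom K (vs K (\<psi> \<odot> \<phi>s)) = vdom K (vs K (hd \<phi>s))"
    "vcod K (vs K (\<psi> \<odot> \<phi>s)) = vcod K (vs K \<psi>)"
    using cell_vmor vcomp_simps by (auto simp: ccomp_simps[OF assms])
qed

text \<open>The associativity axiom requires composability on both sides; for a single inner cell
  the two nested conditions follow from the two assumed ones, so only these remain to be checked in
  calculations.\<close>

lemma ccomp_assoc_singleton:
  assumes "composable K \<chi> [\<psi>]" "composable K \<psi> \<phi>s"
  shows "\<chi> \<odot> [\<psi> \<odot> \<phi>s] = (\<chi> \<odot> [\<psi>]) \<odot> \<phi>s"
proof -
  have "composable K \<chi> [\<psi> \<odot> \<phi>s]"
    using assms by (simp add: composable_iff ccomp_vs_vdom_vcod) (simp add: ccomp_simps)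
  moreover have "composable K (\<chi> \<odot> [\<psi>]) \<phi>s"
    using assms(2) ccomp_simps[OF assms(1)] ccomp_vs_vdom_vcod[OF assms(1)]
    by (simp add: composable_def)
  ultimately show ?thesis
    using ccomp_assoc[of "[\<psi>]" "[\<phi>s]" \<chi>] assms by simp
qed

text \<open>This is the interchange law behind all later calculations: cells placed side by side may
  be composed columnwise or rowwise. The matching of \<open>\<phi>\<^sub>1\<close> and
  \<open>\<phi>\<^sub>2\<close> along their common vertical boundary is assumed separately.\<close>

lemma ccomp_assoc_pair:
  assumes "composable K \<chi> [\<psi>\<^sub>1, \<psi>\<^sub>2]" "composable K \<psi>\<^sub>1 [\<phi>\<^sub>1]" "composable K \<psi>\<^sub>2 [\<phi>\<^sub>2]"
    and "vt K \<phi>\<^sub>1 = vs K \<phi>\<^sub>2"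
  shows "\<chi> \<odot> [\<psi>\<^sub>1 \<odot> [\<phi>\<^sub>1], \<psi>\<^sub>2 \<odot> [\<phi>\<^sub>2]] = (\<chi> \<odot> [\<psi>\<^sub>1, \<psi>\<^sub>2]) \<odot> [\<phi>\<^sub>1, \<phi>\<^sub>2]"
proof -
  have "composable K \<chi> [\<psi>\<^sub>1 \<odot> [\<phi>\<^sub>1], \<psi>\<^sub>2 \<odot> [\<phi>\<^sub>2]]"
    using assms ccomp_vs_vdom_vcod[OF assms(2)] ccomp_simps[OF assms(2)] ccomp_simps[OF assms(3)]
    by (simp add: composable_iff)
  moreover have "composable K (\<chi> \<odot> [\<psi>\<^sub>1, \<psi>\<^sub>2]) [\<phi>\<^sub>1, \<phi>\<^sub>2]"
    using assms ccomp_vs_vdom_vcod[OF assms(1)] ccomp_simps[OF assms(1)]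
    by (simp add: composable_iff)
  ultimately show ?thesis
    using ccomp_assoc[of "[\<psi>\<^sub>1, \<psi>\<^sub>2]" "[[\<phi>\<^sub>1], [\<phi>\<^sub>2]]" \<chi>] assms by simp
qed

lemma ccomp_vidc_left:
  assumes "composable K \<psi> [vidc K f, \<phi>]" "composable K \<psi> [\<phi>]" "f \<in> VMor K"
  shows "\<psi> \<odot> [vidc K f, \<phi>] = \<psi> \<odot> [\<phi>]"
  using ccomp_insert_vidc[of f \<psi> "[]" "[\<phi>]"] assms by simp

lemma ccomp_vidc_right:
  assumes "composable K \<psi> [\<phi>, vidc K f]" "composable K \<psi> [\<phi>]" "f \<in> VMor K"
  shows "\<psi> \<odot> [\<phi>, vidc K f] = \<psi> \<odot> [\<phi>]"
  using ccomp_insert_vidc[of f \<psi> "[\<phi>]" "[]"] assms by simp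

lemmas vidc_simps = vidc_cell[THEN cell_simps(1)] vidc_cell[THEN cell_simps(2)]
  vidc_cell[THEN cell_simps(3)] vidc_cell[THEN cell_simps(4)] vidc_cell[THEN cell_simps(5)]

end

section \<open>Companion identities\<close>

text \<open>Only the vertical companion identity is assumed. It already makes factorizations exist,
  and leaving the horizontal identity out allows these factorizations to be used in deriving it from
  a universal property.\<close>

locale companion_data = avdc +
  fixes f A C J \<psi> \<phi>
  assumes f: "vmor K f A C" and J: "hmor K J A C"
    and \<psi>: "cell K \<psi> [J] [] f (vid K C)" and \<phi>: "cell K \<phi> [] [J] (vid K A) f"
    and vertical_identity: "\<psi> \<odot> [\<phi>] = vidc K f"
begin

lemmas bd = cell_simps[OF \<psi>] cell_simps[OF \<phi>] vmor_simps[OF f] cell_simps[OF hidc_cell[OF J]]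
  vid_simps[OF vmor_simps(4)[OF f]] vid_simps[OF vmor_simps(5)[OF f]]
  vcomp_unit vcomp_simps vidc_simps

lemma J_HMor: "J \<in> HMor K"
  using J by (simp add: hmor_def)

lemma hidc_ccomp_J: "\<theta> \<in> Cell K \<Longrightarrow> ht K \<theta> = [J] \<Longrightarrow> vcod K (vs K \<theta>) = A \<Longrightarrow> hidc K J \<odot> [\<theta>] = \<theta>"
  using hidc_ccomp[OF J_HMor, of \<theta>] by (simp add: composable_iff bd)

lemma ccomp_hidc_J: "\<theta> \<in> Cell K \<Longrightarrow> hs K \<theta> = [J] \<Longrightarrow> vdom K (vs K \<theta>) = A \<Longrightarrow> \<theta> \<odot> [hidc K J] = \<theta>"
  using ccomp_hidc[of "[J]" \<theta>] J_HMor by (simp add: composable_iff bd)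

text \<open>Since \<open>\<chi>\<close> has vertical source \<open>f \<cdot> h\<close>, it can be
  placed to the right of \<open>\<phi>\<close> restricted along \<open>h\<close>. Composing with
  \<open>\<psi>\<close> meets only the left column, where \<open>\<psi> \<circ> (\<phi>)\<close>
  becomes a vertical identity cell and disappears.\<close>

lemma cartesian_factorization:
  assumes h: "vmor K h X A" and k: "vmor K k Y C" and \<chi>: "cell K \<chi> Hs [] (f \<cdot> h) k"
  shows "cell K (hidc K J \<odot> [\<phi> \<odot> [vidc K h], \<chi>]) Hs [J] h k"
    and "\<psi> \<odot> [hidc K J \<odot> [\<phi> \<odot> [vidc K h], \<chi>]] = \<chi>"
proof -
  note bd' = bd cell_simps[OF \<chi>] vmor_simps[OF h] vmor_simps[OF k]
  have c1: "composable K \<phi> [vidc K h]" by (simp add: composable_iff bd')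
  note s1 = ccomp_simps[OF c1, simplified bd', simplified]
  have c2: "composable K (hidc K J) [\<phi> \<odot> [vidc K h], \<chi>]"
    by (simp add: composable_iff bd' s1)
  show "cell K (hidc K J \<odot> [\<phi> \<odot> [vidc K h], \<chi>]) Hs [J] h k"
    using ccomp_cell[OF c2] by (simp add: bd' s1)
  have "\<psi> \<odot> [hidc K J \<odot> [\<phi> \<odot> [vidc K h], \<chi>]] = (\<psi> \<odot> [hidc K J]) \<odot> [\<phi> \<odot> [vidc K h], \<chi>]"
    by (rule ccomp_assoc_singleton[OF _ c2]) (simp add: composable_iff bd')
  \<comment> \<open>Both sides equal \<open>\<psi>\<close>. The padded form has two inputs, so
    interchange can send \<open>\<psi>\<close> to the left column and an identity cell to the right
    one.\<close>
  also have "\<psi> \<odot> [hidc K J] = vidc K (vid K C) \<odot> [\<psi>, vidc K (vid K C)]"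
    using ccomp_hidc_J[of \<psi>] vidc_ccomp[of C \<psi>]
      ccomp_vidc_right[of "vidc K (vid K C)" \<psi> "vid K C"]
    by (simp add: composable_iff bd')
  also have "\<dots> \<odot> [\<phi> \<odot> [vidc K h], \<chi>] =
      vidc K (vid K C) \<odot> [\<psi> \<odot> [\<phi> \<odot> [vidc K h]], vidc K (vid K C) \<odot> [\<chi>]]"
    by (rule ccomp_assoc_pair[symmetric]) (simp_all add: composable_iff bd' s1)
  also have "\<psi> \<odot> [\<phi> \<odot> [vidc K h]] = (\<psi> \<odot> [\<phi>]) \<odot> [vidc K h]"
    by (rule ccomp_assoc_singleton[OF _ c1]) (simp add: composable_iff bd')
  also have "\<dots> = vidc K (f \<cdot> h)"
    using vidc_vcomp[OF h f] by (simp add: vertical_identity)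
  also have \<chi>': "vidc K (vid K C) \<odot> [\<chi>] = \<chi>"
    by (rule vidc_ccomp) (simp_all add: composable_iff bd')
  also have "vidc K (vid K C) \<odot> [vidc K (f \<cdot> h), \<chi>] = \<chi>"
    using \<chi>' ccomp_vidc_left[of "vidc K (vid K C)" "f \<cdot> h" \<chi>] by (simp add: composable_iff bd')
  finally show "\<psi> \<odot> [hidc K J \<odot> [\<phi> \<odot> [vidc K h], \<chi>]] = \<chi>" .
qed

text \<open>Dually, \<open>\<chi>\<close> has vertical target \<open>k \<cdot> f\<close> and fits to
  the left of \<open>\<psi>\<close> extended along \<open>k\<close>. The cell \<open>\<iota>\<close>
  stands for the identity on \<open>Ks\<close>, covering targets of length zero and one at
  once.\<close>

lemma weakly_cocartesian_factorization:
  assumes h: "vmor K h A X" and k: "vmor K k C Y" and \<chi>: "cell K \<chi> [] Ks h (k \<cdot> f)"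
    and \<iota>: "cell K \<iota> Ks Ks (vid K X) (vid K Y)"
    and \<iota>_\<chi>: "\<iota> \<odot> [\<chi>] = \<chi>"
  shows "cell K (\<iota> \<odot> [\<chi>, vidc K k \<odot> [\<psi>]]) [J] Ks h k"
    and "(\<iota> \<odot> [\<chi>, vidc K k \<odot> [\<psi>]]) \<odot> [\<phi>] = \<chi>"
proof -
  note bd' = bd cell_simps[OF \<chi>] cell_simps[OF \<iota>] vmor_simps[OF h] vmor_simps[OF k]
    vid_simps[OF vmor_simps(5)[OF h]] vid_simps[OF vmor_simps(5)[OF k]]
  have c1: "composable K (vidc K k) [\<psi>]" by (simp add: composable_iff bd')
  note s1 = ccomp_simps[OF c1, simplified bd', simplified]
  have c2: "composable K \<iota> [\<chi>, vidc K k \<odot> [\<psi>]]"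
    by (simp add: composable_iff bd' s1)
  show c: "cell K (\<iota> \<odot> [\<chi>, vidc K k \<odot> [\<psi>]]) [J] Ks h k"
    using ccomp_cell[OF c2] by (simp add: bd' s1)
  \<comment> \<open>Padding \<open>\<phi>\<close> with an identity cell on the left supplies an
    input for the column of \<open>\<chi>\<close>, so that \<open>\<phi>\<close> meets only
    \<open>\<psi>\<close>.\<close>
  have "(\<iota> \<odot> [\<chi>, vidc K k \<odot> [\<psi>]]) \<odot> [\<phi>] = (\<iota> \<odot> [\<chi>, vidc K k \<odot> [\<psi>]]) \<odot> [vidc K (vid K A), \<phi>]"
    by (rule ccomp_vidc_left[symmetric]) (simp_all add: composable_iff bd' cell_simps[OF c])
  also have "\<dots> = \<iota> \<odot> [\<chi> \<odot> [vidc K (vid K A)], (vidc K k \<odot> [\<psi>]) \<odot> [\<phi>]]"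
    by (rule ccomp_assoc_pair[symmetric, OF c2]) (simp_all add: composable_iff bd' s1)
  also have "\<chi> \<odot> [vidc K (vid K A)] = \<chi>"
    by (rule ccomp_vidc) (simp_all add: composable_iff bd')
  also have "(vidc K k \<odot> [\<psi>]) \<odot> [\<phi>] = vidc K k \<odot> [\<psi> \<odot> [\<phi>]]"
    by (rule ccomp_assoc_singleton[symmetric, OF c1]) (simp add: composable_iff bd')
  also have "\<dots> = vidc K (k \<cdot> f)"
    using vidc_vcomp[OF f k] by (simp add: vertical_identity)
  also have "\<iota> \<odot> [\<chi>, vidc K (k \<cdot> f)] = \<chi>"
    using \<iota>_\<chi> ccomp_vidc_right[of \<iota> \<chi> "k \<cdot> f"] by (simp add: composable_iff bd')
  finally show "(\<iota> \<odot> [\<chi>, vidc K k \<odot> [\<psi>]]) \<odot> [\<phi>] = \<chi>" .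
qed

end

section \<open>The companion identities imply both universal properties\<close>

locale companion_pair = companion_data +
  assumes horizontal_identity: "hidc K J \<odot> [\<phi>, \<psi>] = hidc K J"
begin

text \<open>Existence is the explicit factorization and uses the vertical identity; uniqueness is
  where the horizontal identity enters.\<close>

lemma cartesian: "cartesian K \<psi>"
  unfolding cartesian_def
proof (intro conjI allI impI)
  show "\<psi> \<in> Cell K" "length (hs K \<psi>) \<le> 1" by (simp_all add: bd)
next
  fix X Y h k Hs \<chi>
  assume "vmor K h X (vdom K (vs K \<psi>)) \<and> vmor K k Y (vdom K (vt K \<psi>)) \<and> hpath K X Hs Y \<and>
    cell K \<chi> Hs (ht K \<psi>) (vs K \<psi> \<cdot> h) (vt K \<psi> \<cdot> k)"
  then have h: "vmor K h X A" and k: "vmor K k Y C" and \<chi>: "cell K \<chi> Hs [] (f \<cdot> h) k"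
    by (auto simp: bd vid_vcomp)
  note bd' = bd vmor_simps[OF h] vmor_simps[OF k]
  show "\<exists>!\<theta>. cell K \<theta> Hs (hs K \<psi>) h k \<and> \<chi> = \<psi> \<odot> [\<theta>]"
  proof (intro ex1I)
    show "cell K (hidc K J \<odot> [\<phi> \<odot> [vidc K h], \<chi>]) Hs (hs K \<psi>) h k \<and>
        \<chi> = \<psi> \<odot> [hidc K J \<odot> [\<phi> \<odot> [vidc K h], \<chi>]]"
      using cartesian_factorization[OF h k \<chi>] by (simp add: bd)
  next
    fix \<theta>
    assume "cell K \<theta> Hs (hs K \<psi>) h k \<and> \<chi> = \<psi> \<odot> [\<theta>]"
    then have \<theta>: "cell K \<theta> Hs [J] h k" and eq: "\<chi> = \<psi> \<odot> [\<theta>]" by (simp_all add: bd)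
    \<comment> \<open>Inserting \<open>\<psi> \<circ> (\<theta>)\<close> for \<open>\<chi>\<close>
      in the explicit formula and regrouping by rows exposes the horizontal identity, after which
      only \<open>\<theta>\<close> is left. Hence every factorization equals the explicit
      one.\<close>
    have "hidc K J \<odot> [\<phi> \<odot> [vidc K h], \<psi> \<odot> [\<theta>]] = (hidc K J \<odot> [\<phi>, \<psi>]) \<odot> [vidc K h, \<theta>]"
      by (rule ccomp_assoc_pair) (simp_all add: composable_iff bd' cell_simps[OF \<theta>])
    also have "\<dots> = hidc K J \<odot> [\<theta>]"
      unfolding horizontal_identity
      by (rule ccomp_vidc_left) (simp_all add: composable_iff bd' cell_simps[OF \<theta>])
    also have "\<dots> = \<theta>" by (rule hidc_ccomp_J) (simp_all add: bd' cell_simps[OF \<theta>])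
    finally show "\<theta> = hidc K J \<odot> [\<phi> \<odot> [vidc K h], \<chi>]" by (simp add: eq)
  qed
qed

lemma weakly_cocartesian: "weakly_cocartesian K \<phi>"
  unfolding weakly_cocartesian_def
proof (intro conjI allI impI)
  show "\<phi> \<in> Cell K" "length (ht K \<phi>) = 1" by (simp_all add: bd)
next
  fix X Y h k Ks \<chi>
  assume *: "vmor K h (vcod K (vs K \<phi>)) X \<and> vmor K k (vcod K (vt K \<phi>)) Y \<and>
    hpath K X Ks Y \<and> length Ks \<le> 1 \<and> cell K \<chi> (hs K \<phi>) Ks (h \<cdot> vs K \<phi>) (k \<cdot> vt K \<phi>)"
  then have h: "vmor K h A X" and k: "vmor K k C Y" and \<chi>: "cell K \<chi> [] Ks h (k \<cdot> f)"
    by (auto simp: bd vcomp_vid)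
  note bd' = bd vmor_simps[OF h] vmor_simps[OF k]
    vid_simps[OF vmor_simps(5)[OF h]] vid_simps[OF vmor_simps(5)[OF k]]
  \<comment> \<open>The identity cell on a path of length at most one: for the empty path it is the
    vertical identity cell of \<open>vid K X\<close>, where \<open>X = Y\<close>; for
    \<open>[M]\<close> it is \<open>hidc K M\<close>.\<close>
  obtain \<iota> where \<iota>: "cell K \<iota> Ks Ks (vid K X) (vid K Y)"
    and \<iota>_unit: "\<And>\<theta>. \<lbrakk>\<theta> \<in> Cell K; ht K \<theta> = Ks; vcod K (vs K \<theta>) = X\<rbrakk> \<Longrightarrow> \<iota> \<odot> [\<theta>] = \<theta>"
  proof (cases Ks)
    case Nil
    with * have "X = Y" by simp
    with Nil show ?thesis
      using that[of "vidc K (vid K X)"] vidc_cell vidc_ccomp by (simp add: composable_iff bd')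
  next
    case (Cons M Ms)
    with * have M: "Ks = [M]" "hmor K M X Y" by (auto simp: hmor_def)
    then have "M \<in> HMor K" by (simp add: hmor_def)
    with M show ?thesis
      using that[of "hidc K M"] hidc_cell[OF M(2)] hidc_ccomp[of M]
      by (simp add: composable_iff bd' cell_simps[OF hidc_cell[OF M(2)]])
  qed
  have \<iota>_\<chi>: "\<iota> \<odot> [\<chi>] = \<chi>" by (rule \<iota>_unit) (simp_all add: bd' cell_simps[OF \<chi>])
  show "\<exists>!\<theta>. cell K \<theta> (ht K \<phi>) Ks h k \<and> \<chi> = \<theta> \<odot> [\<phi>]"
  proof (intro ex1I)
    show "cell K (\<iota> \<odot> [\<chi>, vidc K k \<odot> [\<psi>]]) (ht K \<phi>) Ks h k \<and>
        \<chi> = (\<iota> \<odot> [\<chi>, vidc K k \<odot> [\<psi>]]) \<odot> [\<phi>]"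
      using weakly_cocartesian_factorization[OF h k \<chi> \<iota> \<iota>_\<chi>] by (simp add: bd)
  next
    fix \<theta>
    assume "cell K \<theta> (ht K \<phi>) Ks h k \<and> \<chi> = \<theta> \<odot> [\<phi>]"
    then have \<theta>: "cell K \<theta> [J] Ks h k" and eq: "\<chi> = \<theta> \<odot> [\<phi>]" by (simp_all add: bd)
    note bd'' = bd' cell_simps[OF \<theta>] cell_simps[OF \<iota>]
    have "\<iota> \<odot> [\<theta> \<odot> [\<phi>], vidc K k \<odot> [\<psi>]] = (\<iota> \<odot> [\<theta>, vidc K k]) \<odot> [\<phi>, \<psi>]"
      by (rule ccomp_assoc_pair) (simp_all add: composable_iff bd'')
    also have "\<iota> \<odot> [\<theta>, vidc K k] = \<iota> \<odot> [\<theta>]"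
      by (rule ccomp_vidc_right) (simp_all add: composable_iff bd'')
    \<comment> \<open>The identity moves from the target side of \<open>\<theta>\<close> to its
      source side, where it can be composed with \<open>\<phi>\<close> and \<open>\<psi>\<close> to
      form the horizontal identity.\<close>
    also have "\<dots> = \<theta> \<odot> [hidc K J]"
      using \<iota>_unit[of \<theta>] ccomp_hidc_J[of \<theta>] by (simp add: bd'')
    also have "\<dots> \<odot> [\<phi>, \<psi>] = \<theta> \<odot> [hidc K J \<odot> [\<phi>, \<psi>]]"
      by (rule ccomp_assoc_singleton[symmetric]) (simp_all add: composable_iff bd'')
    also have "\<dots> = \<theta>"
      unfolding horizontal_identity by (rule ccomp_hidc_J) (simp_all add: bd'')
    finally show "\<theta> = \<iota> \<odot> [\<chi>, vidc K k \<odot> [\<psi>]]" by (simp add: eq)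
  qed
qed

end

section \<open>Each universal property yields the companion identities\<close>

context avdc
begin

lemma cart_companion_imp_companion_pair:
  assumes "cart_companion K f J \<psi>"
  obtains A C \<phi> where "companion_pair K f A C J \<psi> \<phi>"
proof -
  obtain A C where f: "vmor K f A C" and J: "hmor K J A C"
    and \<psi>: "cell K \<psi> [J] [] f (vid K C)" and cart: "cartesian K \<psi>"
    using assms unfolding cart_companion_def by blast
  note bd = cell_simps[OF \<psi>] vmor_simps[OF f] vid_simps[OF vmor_simps(4)[OF f]]
    vid_simps[OF vmor_simps(5)[OF f]] vcomp_unit
  have factor: "\<exists>!\<theta>. cell K \<theta> Hs [J] h k \<and> \<chi> = \<psi> \<odot> [\<theta>]"
    if "vmor K h X A" "vmor K k Y C" "hpath K X Hs Y" "cell K \<chi> Hs [] (f \<cdot> h) k"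
    for X Y h k Hs \<chi>
    using cart that unfolding cartesian_def by (simp add: bd vid_vcomp)
  \<comment> \<open>The cell \<open>\<phi>\<close> is the factorization of \<open>vidc K f\<close>
    through \<open>\<psi>\<close>, so the vertical identity holds by construction.\<close>
  obtain \<phi> where \<phi>: "cell K \<phi> [] [J] (vid K A) f" and eq: "\<psi> \<odot> [\<phi>] = vidc K f"
    using ex1_implies_ex[OF factor[OF vid_vmor f, of "[]" "vidc K f"]] vidc_cell[of f]
    by (auto simp: bd)
  interpret companion_data K f A C J \<psi> \<phi>
    by unfold_locales (fact f J \<psi> \<phi> eq)+
  have \<phi>_vid: "\<phi> \<odot> [vidc K (vid K A)] = \<phi>"
    by (rule ccomp_vidc) (simp_all add: composable_iff bd)
  have \<psi>': "cell K \<psi> [J] [] (f \<cdot> vid K A) (vid K C)" using \<psi> by (simp add: bd)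
  have "hpath K A [J] C" using J hmor_obj by (auto simp: hmor_def)
  with factor[OF vid_vmor vid_vmor _ \<psi>']
  have unique: "\<exists>!\<theta>. cell K \<theta> [J] [J] (vid K A) (vid K C) \<and> \<psi> = \<psi> \<odot> [\<theta>]"
    by (simp add: bd)
  have "cell K (hidc K J) [J] [J] (vid K A) (vid K C)" by (rule hidc_cell[OF J])
  moreover have "\<psi> \<odot> [hidc K J] = \<psi>" by (rule ccomp_hidc_J) (simp_all add: bd)
  \<comment> \<open>The explicit factorization of \<open>\<psi>\<close> through itself is
    \<open>hidc K J \<odot> [\<phi>, \<psi>]\<close>. As \<open>hidc K J\<close> is another one,
    uniqueness gives the horizontal identity.\<close>
  moreover have "cell K (hidc K J \<odot> [\<phi>, \<psi>]) [J] [J] (vid K A) (vid K C)"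
    "\<psi> \<odot> [hidc K J \<odot> [\<phi>, \<psi>]] = \<psi>"
    using cartesian_factorization[OF vid_vmor vid_vmor \<psi>'] by (simp_all add: bd \<phi>_vid)
  ultimately have "hidc K J \<odot> [\<phi>, \<psi>] = hidc K J"
    using unique by metis
  then have "companion_pair K f A C J \<psi> \<phi>" by unfold_locales
  then show thesis by (rule that)
qed

lemma wcocart_companion_imp_companion_pair:
  assumes "wcocart_companion K f J \<phi>"
  obtains A C \<psi> where "companion_pair K f A C J \<psi> \<phi>"
proof -
  obtain A C where f: "vmor K f A C" and J: "hmor K J A C"
    and \<phi>: "cell K \<phi> [] [J] (vid K A) f" and cocart: "weakly_cocartesian K \<phi>"
    using assms unfolding wcocart_companion_def by blast
  note bd = cell_simps[OF \<phi>] vmor_simps[OF f] vid_simps[OF vmor_simps(4)[OF f]]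
    vid_simps[OF vmor_simps(5)[OF f]] vcomp_unit
  have factor: "\<exists>!\<theta>. cell K \<theta> [J] Ks h k \<and> \<chi> = \<theta> \<odot> [\<phi>]"
    if "vmor K h A X" "vmor K k C Y" "hpath K X Ks Y" "length Ks \<le> 1" "cell K \<chi> [] Ks h (k \<cdot> f)"
    for X Y h k Ks \<chi>
    using cocart that unfolding weakly_cocartesian_def by (simp add: bd vcomp_vid)
  \<comment> \<open>Here the vertical identity cell of \<open>f\<close> is factored through
    \<open>\<phi>\<close> instead.\<close>
  obtain \<psi> where \<psi>: "cell K \<psi> [J] [] f (vid K C)" and eq: "\<psi> \<odot> [\<phi>] = vidc K f"
    using ex1_implies_ex[OF factor[OF f vid_vmor, of "[]" "vidc K f"]] vidc_cell[of f]
    by (auto simp: bd)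
  interpret companion_data K f A C J \<psi> \<phi>
    by unfold_locales (fact f J \<psi> \<phi> eq)+
  have \<psi>_vid: "vidc K (vid K C) \<odot> [\<psi>] = \<psi>"
    by (rule vidc_ccomp) (simp_all add: composable_iff bd)
  have \<phi>': "cell K \<phi> [] [J] (vid K A) (vid K C \<cdot> f)" using \<phi> by (simp add: bd)
  have "hpath K A [J] C" using J hmor_obj by (auto simp: hmor_def)
  with factor[OF vid_vmor vid_vmor _ _ \<phi>']
  have unique: "\<exists>!\<theta>. cell K \<theta> [J] [J] (vid K A) (vid K C) \<and> \<phi> = \<theta> \<odot> [\<phi>]"
    by (simp add: bd)
  have id_J: "cell K (hidc K J) [J] [J] (vid K A) (vid K C)" by (rule hidc_cell[OF J])
  have \<phi>_id: "hidc K J \<odot> [\<phi>] = \<phi>" by (rule hidc_ccomp_J) (simp_all add: bd)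
  \<comment> \<open>With \<open>\<iota>\<close> taken to be \<open>hidc K J\<close>, the explicit
    formula factors \<open>\<phi>\<close> through itself, and uniqueness compares it with
    \<open>hidc K J\<close>.\<close>
  have "cell K (hidc K J \<odot> [\<phi>, \<psi>]) [J] [J] (vid K A) (vid K C)"
    "(hidc K J \<odot> [\<phi>, \<psi>]) \<odot> [\<phi>] = \<phi>"
    using weakly_cocartesian_factorization[OF vid_vmor vid_vmor \<phi>' id_J \<phi>_id]
    by (simp_all add: bd \<psi>_vid)
  then have "hidc K J \<odot> [\<phi>, \<psi>] = hidc K J"
    using unique id_J \<phi>_id by metis
  then have "companion_pair K f A C J \<psi> \<phi>" by unfold_locales
  then show thesis by (rule that)
qed

end

section \<open>Functors preserve companion pairs, hence the cells defining companions\<close>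

context avdc_functor
begin

lemma companion_pair_image:
  assumes "companion_pair K f A C J \<psi> \<phi>"
  shows "companion_pair L (FV F f) (FO F A) (FO F C) (FH F J) (FC F \<psi>) (FC F \<phi>)"
proof -
  interpret companion_pair K f A C J \<psi> \<phi> by (fact assms)
  show ?thesis
  proof
    show "vmor L (FV F f) (FO F A) (FO F C)" by (rule FV_vmor[OF f])
    show "hmor L (FH F J) (FO F A) (FO F C)" by (rule FH_hmor[OF J])
    show "cell L (FC F \<psi>) [FH F J] [] (FV F f) (vid L (FO F C))"
      using FC_cell[OF \<psi>] by (simp add: FV_vid bd)
    show "cell L (FC F \<phi>) [] [FH F J] (vid L (FO F A)) (FV F f)"
      using FC_cell[OF \<phi>] by (simp add: FV_vid bd)
    show "FC F \<psi> \<odot>\<^bsub>L\<^esub> [FC F \<phi>] = vidc L (FV F f)"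
      using FC_ccomp[of \<psi> "[\<phi>]"] by (simp add: source.composable_iff bd vertical_identity FC_vidc)
    show "hidc L (FH F J) \<odot>\<^bsub>L\<^esub> [FC F \<phi>, FC F \<psi>] = hidc L (FH F J)"
      using FC_ccomp[of "hidc K J" "[\<phi>, \<psi>]"]
      by (simp add: source.composable_iff bd horizontal_identity FC_hidc J_HMor)
  qed
qed

lemma cart_companion_image:
  assumes "cart_companion K f J \<psi>"
  shows "cartesian L (FC F \<psi>)"
proof -
  obtain A C \<phi> where "companion_pair K f A C J \<psi> \<phi>"
    using assms by (rule source.cart_companion_imp_companion_pair)
  then show ?thesis
    by (rule companion_pair.cartesian[OF companion_pair_image])
qed

lemma wcocart_companion_image:
  assumes "wcocart_companion K f J \<phi>"
  shows "weakly_cocartesian L (FC F \<phi>)"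
proof -
  obtain A C \<psi> where "companion_pair K f A C J \<psi> \<phi>"
    using assms by (rule source.wcocart_companion_imp_companion_pair)
  then show ?thesis
    by (rule companion_pair.weakly_cocartesian[OF companion_pair_image])
qed

end

section \<open>Horizontal duality\<close>

text \<open>The horizontal dual. Vertical category, horizontal morphisms and cells stay the same as
  sets, so the unchanged \<open>F\<close> can serve as a functor between duals.\<close>

definition hop :: "('o, 'v, 'h, 'c) avdc_data \<Rightarrow> ('o, 'v, 'h, 'c) avdc_data" where
  "hop K = K\<lparr>hdom := hcod K, hcod := hdom K, hs := \<lambda>\<phi>. rev (hs K \<phi>), ht := \<lambda>\<phi>. rev (ht K \<phi>),
     vs := vt K, vt := vs K, ccomp := \<lambda>\<psi> \<phi>s. ccomp K \<psi> (rev \<phi>s)\<rparr>"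

lemma hop_simps [simp]:
  "Obj (hop K) = Obj K" "VMor (hop K) = VMor K" "vdom (hop K) = vdom K" "vcod (hop K) = vcod K"
  "vid (hop K) = vid K" "vcomp (hop K) = vcomp K" "HMor (hop K) = HMor K"
  "hdom (hop K) = hcod K" "hcod (hop K) = hdom K" "Cell (hop K) = Cell K"
  "hs (hop K) = (\<lambda>\<phi>. rev (hs K \<phi>))" "ht (hop K) = (\<lambda>\<phi>. rev (ht K \<phi>))"
  "vs (hop K) = vt K" "vt (hop K) = vs K" "ccomp (hop K) = (\<lambda>\<psi> \<phi>s. ccomp K \<psi> (rev \<phi>s))"
  "hidc (hop K) = hidc K" "vidc (hop K) = vidc K"
  by (simp_all add: hop_def)

text \<open>Involutivity upgrades the one-way implications about cell paths and universal cells
  below to equivalences.\<close>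

lemma hop_hop: "hop (hop K) = K"
  by (simp add: hop_def)

lemma vmor_hop [simp]: "vmor (hop K) f A C \<longleftrightarrow> vmor K f A C"
  by (simp add: vmor_def)

lemma hmor_hop [simp]: "hmor (hop K) J A B \<longleftrightarrow> hmor K J B A"
  by (auto simp: hmor_def)

lemma cell_hop: "cell (hop K) \<phi> Js Ks f g \<longleftrightarrow> cell K \<phi> (rev Js) (rev Ks) g f"
  by (auto simp: cell_def)

lemma cell_path_imp_cell_path_hop:
  assumes "cell_path K \<phi>s"
  shows "cell_path (hop K) (rev \<phi>s)"
  unfolding cell_path_def
proof (intro conjI allI impI)
  show "rev \<phi>s \<noteq> []" "set (rev \<phi>s) \<subseteq> Cell (hop K)"
    using assms by (auto simp: cell_path_def)
next
  fix i
  assume i: "Suc i < length (rev \<phi>s)"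
  \<comment> \<open>Entries \<open>i\<close> and \<open>Suc i\<close> of the reversed list are
    entries \<open>Suc ?j\<close> and \<open>?j\<close> of the original, which explains the offset
    by two.\<close>
  let ?j = "length \<phi>s - Suc (Suc i)"
  have "vt K (\<phi>s ! ?j) = vs K (\<phi>s ! Suc ?j)" using assms i by (simp add: cell_path_def)
  moreover have "Suc ?j = length \<phi>s - Suc i" using i by simp
  ultimately show "vt (hop K) (rev \<phi>s ! i) = vs (hop K) (rev \<phi>s ! Suc i)"
    using i by (simp add: rev_nth)
qed

lemma cell_path_hop: "cell_path (hop K) \<phi>s \<longleftrightarrow> cell_path K (rev \<phi>s)"
  using cell_path_imp_cell_path_hop[of K "rev \<phi>s"] cell_path_imp_cell_path_hop[of "hop K" \<phi>s]
  by (auto simp: hop_hop)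

lemma concat_map_rev: "concat (map (\<lambda>x. rev (g x)) xs) = rev (concat (map g (rev xs)))"
  by (simp add: rev_concat rev_map comp_def)

section \<open>Axioms and universal cells in the horizontal dual\<close>

context avdc
begin

lemma hpath_hop: "hpath (hop K) B Js A \<longleftrightarrow> hpath K A (rev Js) B"
proof -
  \<comment> \<open>\<open>hpath\<close> recurses from the front, whereas reversal appends at the
    back, so the last edge has to be split off as well.\<close>
  have snoc: "hpath K X (Ks @ [J]) Y \<longleftrightarrow> hpath K X Ks (hdom K J) \<and> J \<in> HMor K \<and> hcod K J = Y"
    for X Ks J Y
    using hmor_obj by (induction Ks arbitrary: X) auto
  show ?thesis
    by (induction Js arbitrary: B) (auto simp: snoc)
qed

text \<open>\<open>composable\<close> compares start objects, which in the dual are the original end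
  objects. The source of \<open>\<psi>\<close> and the joined targets of the inputs are the same
  list, and either end object of a path determines the other.\<close>

lemma composable_hop: "composable (hop K) \<psi> \<phi>s \<longleftrightarrow> composable K \<psi> (rev \<phi>s)"
proof -
  have "vdom K (vt K \<psi>) = vcod K (vt K (last \<phi>s')) \<longleftrightarrow> vdom K (vs K \<psi>) = vcod K (vs K (hd \<phi>s'))"
    if "\<psi> \<in> Cell K" "cell_path K \<phi>s'" "hs K \<psi> = concat (map (ht K) \<phi>s')" for \<phi>s'
    using cell_hs[OF that(1)] cell_path_ht[OF that(2)] that(3) hpath_unique_start hpath_unique_end
    by metis
  from this[of "rev \<phi>s"] show ?thesis
    by (auto simp: composable_def cell_path_hop concat_map_rev hd_rev last_rev)
qed

text \<open>The four axioms with inputs in lists of arbitrary length are treated separately: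
  associativity, the boundary of a composite, identity paths, and insertion of vertical identity
  cells. The rest dualize directly.\<close>

lemma avdc_hop: "avdc (hop K)"
proof (unfold_locales, goal_cases)
  case (16 \<psi>s \<phi>ss \<chi>)
  have len: "length \<psi>s = length \<phi>ss" using 16(1) by (rule list_all2_lengthD)
  \<comment> \<open>For nested inputs the outer list and every inner list are reversed; this is what
    makes the reversed concatenation a concatenation again.\<close>
  let ?\<psi>s = "rev \<psi>s" and ?\<phi>ss = "map rev (rev \<phi>ss)"
  have *: "rev (map2 (ccomp (hop K)) \<psi>s \<phi>ss) = map2 (\<odot>) ?\<psi>s ?\<phi>ss"
    using len by (simp add: rev_map zip_rev zip_map2 comp_def case_prod_unfold)
  have **: "rev (concat \<phi>ss) = concat ?\<phi>ss" by (simp add: rev_concat rev_map)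
  have "list_all2 (composable K) ?\<psi>s ?\<phi>ss"
    using 16(1) by (auto simp: list_all2_map2 composable_hop elim: list_all2_mono)
  moreover have "composable K \<chi> (map2 (\<odot>) ?\<psi>s ?\<phi>ss)"
    using 16(2) unfolding composable_hop * .
  moreover have "composable K \<chi> ?\<psi>s"
    using 16(3) by (simp add: composable_hop)
  moreover have "composable K (\<chi> \<odot> ?\<psi>s) (concat ?\<phi>ss)"
    using 16(4) unfolding composable_hop ** by simp
  ultimately have "\<chi> \<odot> map2 (\<odot>) ?\<psi>s ?\<phi>ss = (\<chi> \<odot> ?\<psi>s) \<odot> concat ?\<phi>ss"
    by (rule ccomp_assoc)
  then show ?case unfolding *[symmetric] **[symmetric] by simp
next
  case (12 \<psi> \<phi>s)
  then have c: "composable K \<psi> (rev \<phi>s)" by (simp add: composable_hop)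
  then have "\<phi>s \<noteq> []" by (auto simp: composable_def cell_path_def)
  then show ?case using ccomp_cell[OF c] by (simp add: cell_hop concat_map_rev hd_rev last_rev)
next
  case (20 Js \<phi>)
  then show ?case using ccomp_hidc[of "rev Js" \<phi>] by (simp add: composable_hop rev_map)
next
  case (21 f \<psi> \<phi>s \<phi>s')
  then show ?case
    using ccomp_insert_vidc[of f \<psi> "rev \<phi>s'" "rev \<phi>s"] by (simp add: composable_hop)
qed (simp_all add: vmor_obj vid_vmor vcomp_vmor vcomp_vid vid_vcomp vcomp_assoc hmor_obj cell_vmor
    cell_hs cell_ht cell_ht_length[simplified] hidc_cell vidc_cell vidc_vcomp vidc_ccomp hidc_ccomp ccomp_vidc
    cell_hop hpath_hop composable_hop)

lemma cartesian_imp_cartesian_hop: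
  assumes "cartesian K \<psi>"
  shows "cartesian (hop K) \<psi>"
  unfolding cartesian_def
proof (intro conjI allI impI)
  show "\<psi> \<in> Cell (hop K)" "length (hs (hop K) \<psi>) \<le> 1"
    using assms by (simp_all add: cartesian_def)
next
  fix X Y h k Hs \<chi>
  assume "vmor (hop K) h X (vdom (hop K) (vs (hop K) \<psi>)) \<and>
    vmor (hop K) k Y (vdom (hop K) (vt (hop K) \<psi>)) \<and> hpath (hop K) X Hs Y \<and>
    cell (hop K) \<chi> Hs (ht (hop K) \<psi>) (vs (hop K) \<psi> \<cdot>\<^bsub>hop K\<^esub> h) (vt (hop K) \<psi> \<cdot>\<^bsub>hop K\<^esub> k)"
  then have "vmor K k Y (vdom K (vs K \<psi>)) \<and> vmor K h X (vdom K (vt K \<psi>)) \<and>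
    hpath K Y (rev Hs) X \<and> cell K \<chi> (rev Hs) (ht K \<psi>) (vs K \<psi> \<cdot> k) (vt K \<psi> \<cdot> h)"
    by (simp add: cell_hop hpath_hop)
  with assms have "\<exists>!\<theta>. cell K \<theta> (rev Hs) (hs K \<psi>) k h \<and> \<chi> = \<psi> \<odot> [\<theta>]"
    unfolding cartesian_def by blast
  then show "\<exists>!\<theta>. cell (hop K) \<theta> Hs (hs (hop K) \<psi>) h k \<and> \<chi> = \<psi> \<odot>\<^bsub>hop K\<^esub> [\<theta>]"
    by (simp add: cell_hop)
qed

lemma weakly_cocartesian_imp_weakly_cocartesian_hop:
  assumes "weakly_cocartesian K \<phi>"
  shows "weakly_cocartesian (hop K) \<phi>"
  unfolding weakly_cocartesian_def
proof (intro conjI allI impI)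
  show "\<phi> \<in> Cell (hop K)" "length (ht (hop K) \<phi>) = 1"
    using assms by (simp_all add: weakly_cocartesian_def)
next
  fix X Y h k Ks \<chi>
  assume "vmor (hop K) h (vcod (hop K) (vs (hop K) \<phi>)) X \<and>
    vmor (hop K) k (vcod (hop K) (vt (hop K) \<phi>)) Y \<and> hpath (hop K) X Ks Y \<and> length Ks \<le> 1 \<and>
    cell (hop K) \<chi> (hs (hop K) \<phi>) Ks (h \<cdot>\<^bsub>hop K\<^esub> vs (hop K) \<phi>) (k \<cdot>\<^bsub>hop K\<^esub> vt (hop K) \<phi>)"
  then have "vmor K k (vcod K (vs K \<phi>)) Y \<and> vmor K h (vcod K (vt K \<phi>)) X \<and>
    hpath K Y (rev Ks) X \<and> length (rev Ks) \<le> 1 \<and>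
    cell K \<chi> (hs K \<phi>) (rev Ks) (k \<cdot> vs K \<phi>) (h \<cdot> vt K \<phi>)"
    by (simp add: cell_hop hpath_hop)
  with assms have "\<exists>!\<theta>. cell K \<theta> (ht K \<phi>) (rev Ks) k h \<and> \<chi> = \<theta> \<odot> [\<phi>]"
    unfolding weakly_cocartesian_def by blast
  then show "\<exists>!\<theta>. cell (hop K) \<theta> (ht (hop K) \<phi>) Ks h k \<and> \<chi> = \<theta> \<odot>\<^bsub>hop K\<^esub> [\<phi>]"
    by (simp add: cell_hop)
qed

lemma cartesian_hop: "cartesian (hop K) \<psi> \<longleftrightarrow> cartesian K \<psi>"
  using cartesian_imp_cartesian_hop avdc.cartesian_imp_cartesian_hop[OF avdc_hop, of \<psi>]
  by (auto simp: hop_hop)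

lemma weakly_cocartesian_hop: "weakly_cocartesian (hop K) \<phi> \<longleftrightarrow> weakly_cocartesian K \<phi>"
  using weakly_cocartesian_imp_weakly_cocartesian_hop
    avdc.weakly_cocartesian_imp_weakly_cocartesian_hop[OF avdc_hop, of \<phi>]
  by (auto simp: hop_hop)

text \<open>Exchanging vertical source and target moves \<open>f\<close> to the other side of the
  cell, and \<open>J\<close> changes direction accordingly.\<close>

lemma cart_companion_hop: "cart_companion (hop K) f J \<psi> \<longleftrightarrow> cart_conjoint K f J \<psi>"
  by (simp add: cart_companion_def cart_conjoint_def cell_hop cartesian_hop)

lemma wcocart_companion_hop: "wcocart_companion (hop K) f J \<phi> \<longleftrightarrow> wcocart_conjoint K f J \<phi>"
  by (simp add: wcocart_companion_def wcocart_conjoint_def cell_hop weakly_cocartesian_hop)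

lemma cart_unit_imp_cart_companion: "cart_unit K A I \<psi> \<Longrightarrow> cart_companion K (vid K A) I \<psi>"
  using vid_vmor by (auto simp: cart_unit_def cart_companion_def)

lemma wcocart_unit_imp_wcocart_companion:
  "wcocart_unit K A I \<phi> \<Longrightarrow> wcocart_companion K (vid K A) I \<phi>"
  using vid_vmor by (auto simp: wcocart_unit_def wcocart_companion_def)

end

section \<open>Transfer of the companion case to conjoints by duality\<close>

context avdc_functor
begin

lemma avdc_functor_hop: "avdc_functor (hop K) (hop L) F"
proof (intro avdc_functor.intro avdc_functor_axioms.intro source.avdc_hop target.avdc_hop,
    goal_cases)
  case (6 \<phi> Js Ks f g)
  then show ?case
    using FC_cell[of \<phi> "rev Js" "rev Ks" g f] by (simp add: cell_hop rev_map)
qed (simp_all add: FO_obj FV_vmor FV_vid FV_vcomp FH_hmor FC_ccomp FC_hidc FC_vidc rev_map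
    source.composable_hop)

lemma cart_conjoint_image:
  assumes "cart_conjoint K f J \<psi>"
  shows "cartesian L (FC F \<psi>)"
  using avdc_functor.cart_companion_image[OF avdc_functor_hop] assms
  by (simp add: source.cart_companion_hop target.cartesian_hop)

lemma wcocart_conjoint_image:
  assumes "wcocart_conjoint K f J \<phi>"
  shows "weakly_cocartesian L (FC F \<phi>)"
  using avdc_functor.wcocart_companion_image[OF avdc_functor_hop] assms
  by (simp add: source.wcocart_companion_hop target.weakly_cocartesian_hop)

end

theorem corollary5p5:
  fixes K :: "('o, 'v, 'h, 'c) avdc_data"
    and L :: "('o', 'v', 'h', 'c') avdc_data"
    and F :: "('o, 'v, 'h, 'c, 'o', 'v', 'h', 'c') avdc_map"
  assumes "avdc_functor K L F"
  shows "(\<forall>f J \<psi>. cart_companion K f J \<psi> \<longrightarrow> cartesian L (FC F \<psi>)) \<and>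
         (\<forall>f J \<psi>. cart_conjoint K f J \<psi> \<longrightarrow> cartesian L (FC F \<psi>)) \<and>
         (\<forall>A I \<psi>. cart_unit K A I \<psi> \<longrightarrow> cartesian L (FC F \<psi>)) \<and>
         (\<forall>f J \<phi>. wcocart_companion K f J \<phi> \<longrightarrow> weakly_cocartesian L (FC F \<phi>)) \<and>
         (\<forall>f J \<phi>. wcocart_conjoint K f J \<phi> \<longrightarrow> weakly_cocartesian L (FC F \<phi>)) \<and>
         (\<forall>A I \<phi>. wcocart_unit K A I \<phi> \<longrightarrow> weakly_cocartesian L (FC F \<phi>))"
proof -
  interpret avdc_functor K L F by (fact assms)
  show ?thesis
    using cart_companion_image cart_conjoint_image wcocart_companion_image wcocart_conjoint_image
      source.cart_unit_imp_cart_companion source.wcocart_unit_imp_wcocart_companion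
    by blast
qed

end
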